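(* For every $x\in\mathbb{R}$, \[ q_{2n}(x) = (-1)^n (1+x^2)^{n+1/2}\, T_{2n+1}\!\left(\frac{1}{\sqrt{1+x^2}}\right)\qquad\text{for all integers } n\ge 0, \] \[ q_{2n-1}(x) = (-1)^n (1+x^2)^{n-1/2}\, x\, U_{2n-1}\!\left(\frac{1}{\sqrt{1+x^2}}\right)\qquad\text{for all integers } n\ge 1, \] where $T_n$ and $U_n$ denote the $n$th Chebyshev polynomials of the first and second kind, respectively.
   Context: For each integer $n\ge 0$, the polynomial $q_n:\mathbb{R}\to\mathbb{R}$ is defined by \[ q_n(x) = (-1)^n \sum_{k\ \text{even},\ 0\le k\le n} \binom{n+1}{k+1} (-1)^{k/2} x^{n-k}, \] with the convention $x^0=1$ for all $x$. *)

theory Defs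
  imports Complex_Main "HOL-Computational_Algebra.Polynomial"
begin

fun Cheb_T :: "nat \<Rightarrow> real poly" where
  "Cheb_T 0 = 1"
| "Cheb_T (Suc 0) = [:0, 1:]"
| "Cheb_T (Suc (Suc n)) = [:0, 2:] * Cheb_T (Suc n) - Cheb_T n"

fun Cheb_U :: "nat \<Rightarrow> real poly" where
  "Cheb_U 0 = 1"
| "Cheb_U (Suc 0) = [:0, 2:]"
| "Cheb_U (Suc (Suc n)) = [:0, 2:] * Cheb_U (Suc n) - Cheb_U n"

(* A function on the reals rather than a poly; x ^ 0 = 1 also at x = 0,
   which is the convention wanted for the term k = n. *)
definition q :: "nat \<Rightarrow> real \<Rightarrow> real" where
  "q n x = (-1) ^ n *
     (\<Sum>k \<in> {k. even k \<and> k \<le> n}. real ((n + 1) choose (k + 1)) * (-1) ^ (k div 2) * x ^ (n - k))"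

end

theory Submission
  imports Defs
begin

text \<open>
  Both families are read off from powers of a complex number: \<open>q n x\<close> is, up to sign, the imaginary
  part of \<open>(x + \<i>) ^ (n + 1)\<close>, while \<open>(c + \<i> s) ^ m = T\<^sub>m(c) + \<i> s U\<^sub>m\<^sub>-\<^sub>1(c)\<close> whenever
  \<open>c\<^sup>2 + s\<^sup>2 = 1\<close>. With \<open>r = sqrt (1 + x\<^sup>2)\<close>, \<open>c = 1 / r\<close> and \<open>s = x / r\<close> the two
  are linked by \<open>x + \<i> = \<i> r (c - \<i> s)\<close>.
\<close>

text \<open>Since \<open>Im (\<i> ^ (k + 1)) = Re (\<i> ^ k)\<close>, this produces both the parity
  filter and the sign in \<open>q\<close>.\<close>

lemma Re_i_power: "Re (\<i> ^ k) = (if even k then (-1) ^ (k div 2) else 0)"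
  by (auto elim!: evenE oddE simp: power_mult power2_eq_square simp flip: of_real_power)

lemma q_eq_Im: "q n x = (-1) ^ n * Im (Complex x 1 ^ (n + 1))"
proof -
  let ?t = "\<lambda>j. real ((n + 1) choose j) * Im (\<i> ^ j) * x ^ (n + 1 - j)"
  have Im_monomial: "Im (of_nat a * \<i> ^ j * of_real x ^ m) = real a * Im (\<i> ^ j) * x ^ m" for a j m
    by (simp flip: of_real_power)
  have "Complex x 1 = \<i> + of_real x"
    by (simp add: complex_eq_iff)
  then have "Im (Complex x 1 ^ (n + 1)) = (\<Sum>j\<le>n + 1. ?t j)"
    by (simp only: binomial_ring Im_sum Im_monomial)
  \<comment> \<open>The term at j = 0 vanishes because Im 1 = 0.\<close>
  also have "\<dots> = (\<Sum>k\<le>n. ?t (k + 1))"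
    by (simp only: Suc_eq_plus1[symmetric] sum.atMost_Suc_shift) simp
  also have "\<dots> = (\<Sum>k\<le>n. if even k
      then real ((n + 1) choose (k + 1)) * (-1) ^ (k div 2) * x ^ (n - k) else 0)"
    by (intro sum.cong refl) (simp add: Re_i_power del: binomial_Suc_Suc)
  also have "\<dots> = (\<Sum>k \<in> {k. even k \<and> k \<le> n}.
      real ((n + 1) choose (k + 1)) * (-1) ^ (k div 2) * x ^ (n - k))"
    by (intro sum.mono_neutral_cong_right) auto
  finally show ?thesis
    by (simp only: q_def)
qed

text \<open>On the unit circle z = c + i s is a root of z^2 = 2 c z - 1, so its powers obey the
  three-term recurrence of both Chebyshev families. Starting at exponent \<open>Suc m\<close> avoids
  an index -1 for U.\<close>

lemma unit_Complex_power_Suc: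
  assumes "c\<^sup>2 + s\<^sup>2 = 1"
  shows "Complex c s ^ Suc m = Complex (poly (Cheb_T (Suc m)) c) (s * poly (Cheb_U m) c)"
proof (induction m rule: Cheb_U.induct)
  case 1
  show ?case by simp
next
  case 2
  show ?case
    using assms by (simp add: complex_eq_iff power2_eq_square algebra_simps)
next
  case (3 m)
  have "Complex c s ^ 2 = of_real (2 * c) * Complex c s - 1"
    using assms by (simp add: complex_eq_iff power2_eq_square algebra_simps)
  then have "Complex c s ^ Suc (Suc (Suc m))
      = Complex c s ^ Suc m * (of_real (2 * c) * Complex c s - 1)"
    by (simp add: power2_eq_square mult_ac)
  also have "\<dots> = of_real (2 * c) * Complex c s ^ Suc (Suc m) - Complex c s ^ Suc m"
    by (simp add: algebra_simps)
  finally show ?case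
    unfolding 3 by (simp add: complex_eq_iff algebra_simps)
qed

theorem proposition4p1:
  fixes x :: real
  shows "(\<forall>n::nat. q (2 * n) x =
            (-1) ^ n * (1 + x\<^sup>2) powr (real n + 1 / 2)
              * poly (Cheb_T (2 * n + 1)) (1 / sqrt (1 + x\<^sup>2)))
       \<and> (\<forall>n::nat. n \<ge> 1 \<longrightarrow> q (2 * n - 1) x =
            (-1) ^ n * (1 + x\<^sup>2) powr (real n - 1 / 2) * x
              * poly (Cheb_U (2 * n - 1)) (1 / sqrt (1 + x\<^sup>2)))"
proof -
  define r where "r = sqrt (1 + x\<^sup>2)"
  have pos: "1 + x\<^sup>2 > 0"
    by (simp add: add_pos_nonneg)
  then have r: "r > 0" "r\<^sup>2 = 1 + x\<^sup>2"
    by (simp_all add: r_def)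
  have unit: "(1 / r)\<^sup>2 + (- x / r)\<^sup>2 = 1"
    using pos r(2) by (simp add: power_divide flip: add_divide_distrib)
  have "Complex x 1 = \<i> * of_real r * Complex (1 / r) (- x / r)"
    using r(1) by (simp add: complex_eq_iff)
  then have z_power: "Complex x 1 ^ Suc m = \<i> ^ Suc m * of_real (r ^ Suc m)
      * Complex (poly (Cheb_T (Suc m)) (1 / r)) (- x / r * poly (Cheb_U m) (1 / r))" for m
    by (simp only: power_mult_distrib unit_Complex_power_Suc[OF unit] of_real_power)
  have i_even: "\<i> ^ (2 * n) = of_real ((-1) ^ n)" for n
    by (simp add: power_mult)
  \<comment> \<open>Both n + 1/2 and n - 1/2 are halves of odd naturals, so the real powers become
    natural powers of r.\<close>
  have powr: "(1 + x\<^sup>2) powr (real m / 2) = r ^ m" for m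
    using r powr_powr[of r 2 "real m / 2"] by (simp add: powr_realpow)
  have "q (2 * n) x = (-1) ^ n * (1 + x\<^sup>2) powr (real n + 1 / 2)
      * poly (Cheb_T (2 * n + 1)) (1 / r)" for n
  proof -
    \<comment> \<open>This factor is purely imaginary, so Im selects the real component, which is
      T.\<close>
    have "\<i> ^ Suc (2 * n) = \<i> * of_real ((-1) ^ n)"
      by (simp only: power_Suc i_even)
    then have "q (2 * n) x = (-1) ^ n * r ^ Suc (2 * n) * poly (Cheb_T (Suc (2 * n))) (1 / r)"
      by (simp only: q_eq_Im Suc_eq_plus1[symmetric] z_power[of "2 * n"])
        (simp del: Cheb_T.simps power_Suc of_real_power)
    moreover have "(1 + x\<^sup>2) powr (real n + 1 / 2) = r ^ Suc (2 * n)"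
      using powr[of "Suc (2 * n)"] by (simp add: add_divide_distrib add.commute)
    ultimately show ?thesis
      by simp
  qed
  moreover have "q (2 * n - 1) x = (-1) ^ n * (1 + x\<^sup>2) powr (real n - 1 / 2) * x
      * poly (Cheb_U (2 * n - 1)) (1 / r)" if "n \<ge> 1" for n
  proof -
    define m where "m = 2 * n - 1"
    with that have m: "2 * n = Suc m" "real n - 1 / 2 = real m / 2"
      by (simp_all add: of_nat_diff field_simps)
    then have "odd m"
      by presburger
    \<comment> \<open>Now the factor is real and Im selects the U component; the sign of
      \<open>- x / r\<close> cancels against (-1)^m, as m is odd.\<close>
    have "\<i> ^ Suc m = of_real ((-1) ^ n)"
      using i_even[of n] m(1) by simp
    then have "q m x = (-1) ^ n * r ^ Suc m * (x / r * poly (Cheb_U m) (1 / r))"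
      using \<open>odd m\<close> by (simp only: q_eq_Im Suc_eq_plus1[symmetric] z_power[of m])
        (simp del: Cheb_U.simps power_Suc of_real_power)
    then show ?thesis
      \<comment> \<open>The denominator in x / r absorbs one factor of
        \<open>r ^ Suc m\<close>.\<close>
      using r(1) unfolding m_def[symmetric] m(2) powr by simp
  qed
  ultimately show ?thesis
    by (simp add: r_def)
qed

end
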